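(* Let $d$ and $t$ be positive integers such that $3 \le t \le d-1$. If $G$ is a $d$-regular simple graph with $$\lambda_2(G) < \frac{d-3+\sqrt{(d+3)^2-8t}}{2},$$ then $\kappa'(G) \ge t+1$. Furthermore, for odd $t$, if $G$ is a $d$-regular simple graph with $$\lambda_2(G) < \frac{d-4+\sqrt{(d+4)^2-8t}}{2},$$ then $\kappa'(G) \ge t+1$.
   Context: Graphs are finite. A simple graph has no loops and no multiple edges. A graph is $d$-regular if every vertex has degree $d$. The eigenvalues of a graph $G$ are the eigenvalues of its adjacency matrix, listed with multiplicity in non-increasing order $\lambda_1(G)\ge \lambda_2(G)\ge\cdots\ge\lambda_{|V(G)|}(G)$; thus $\lambda_2(G)$ is the second largest eigenvalue. A graph $G$ is $m$-edge-connected if for every $F\subseteq E(G)$ with $|F|<m$ the graph $G-F$ (obtained by deleting the edges in $F$) is connected. The edge-connectivity $\kappa'(G)$ is the maximum $m$ such that $G$ is $m$-edge-connected. *)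

theory Defs
  imports Complex_Main "HOL-Combinatorics.Permutations" "Jordan_Normal_Form.Char_Poly"
begin

text \<open>A finite simple graph is given by its vertex set and its set of edges, an edge being
  a two-element set of vertices. As usual, a graph has at least one vertex.\<close>

locale simple_graph =
  fixes V :: "'a set" and E :: "'a set set"
  assumes finite_vertices: "finite V"
    and vertices_nonempty: "V \<noteq> {}"
    and edges: "e \<in> E \<Longrightarrow> e \<subseteq> V \<and> card e = 2"

definition vertex_degree :: "'a set set \<Rightarrow> 'a \<Rightarrow> nat" where
  "vertex_degree E v = card {e \<in> E. v \<in> e}"

definition regular :: "nat \<Rightarrow> 'a set \<Rightarrow> 'a set set \<Rightarrow> bool" where
  "regular d V E \<longleftrightarrow> (\<forall>v\<in>V. vertex_degree E v = d)"

definition connected_graph :: "'a set \<Rightarrow> 'a set set \<Rightarrow> bool" where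
  "connected_graph V E \<longleftrightarrow> (\<forall>u\<in>V. \<forall>v\<in>V. (u, v) \<in> {(x, y). {x, y} \<in> E}\<^sup>*)"

definition edge_connected :: "nat \<Rightarrow> 'a set \<Rightarrow> 'a set set \<Rightarrow> bool" where
  "edge_connected m V E \<longleftrightarrow> (\<forall>F \<subseteq> E. card F < m \<longrightarrow> connected_graph V (E - F))"

text \<open>The maximum exists as soon as there are at least two vertices. The one-vertex graph
  is \<open>m\<close>-edge-connected for all \<open>m\<close>, and the value below is then unspecified.\<close>

definition edge_connectivity :: "'a set \<Rightarrow> 'a set set \<Rightarrow> nat" where
  "edge_connectivity V E = (GREATEST m. edge_connected m V E)"

definition adjacency_matrix :: "'a list \<Rightarrow> 'a set set \<Rightarrow> real mat" where
  "adjacency_matrix vs E = mat (length vs) (length vs)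
     (\<lambda>(i, j). if {vs ! i, vs ! j} \<in> E then 1 else 0)"

definition vertex_list :: "'a set \<Rightarrow> 'a list" where
  "vertex_list V = (SOME vs. distinct vs \<and> set vs = V)"

definition graph_char_poly :: "'a set \<Rightarrow> 'a set set \<Rightarrow> real poly" where
  "graph_char_poly V E = char_poly (adjacency_matrix (vertex_list V) E)"

text \<open>The choice of the enumeration of the vertices is immaterial.\<close>

lemma char_poly_adjacency_matrix_enumeration:
  assumes "distinct vs" "distinct ws" "set vs = set ws"
  shows "char_poly (adjacency_matrix vs E) = char_poly (adjacency_matrix ws E)"
proof -
  let ?n = "length ws"
  let ?C = "char_poly_matrix (adjacency_matrix ws E)"
  have "mset vs = mset ws"
    using assms set_eq_iff_mset_eq_distinct by blast
  then obtain p where p: "p permutes {..<?n}" and vs: "permute_list p ws = vs"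
    by (rule mset_eq_permutation)
  have p0: "p permutes {0..<?n}" using p by (simp add: atLeast0LessThan)
  have len: "length vs = ?n" using vs by auto
  have nth: "vs ! i = ws ! p i" if "i < ?n" for i
    using permute_list_nth[OF p that] vs by simp
  have pl: "p i < ?n" if "i < ?n" for i
    using permutes_in_image[OF p] that by auto
  have pinj: "p i = p j \<longleftrightarrow> i = j" for i j
    using permutes_inj[OF p] by (auto dest: injD)
  have C: "?C \<in> carrier_mat ?n ?n"
    by (auto simp: adjacency_matrix_def char_poly_matrix_def)
  define D where "D = mat ?n ?n (\<lambda>(i, j). ?C $$ (p i, j))"
  have D: "D \<in> carrier_mat ?n ?n" by (simp add: D_def)
  have "char_poly_matrix (adjacency_matrix vs E)
      = transpose_mat (mat ?n ?n (\<lambda>(i, j). transpose_mat D $$ (p i, j)))"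
    by (rule eq_matI)
      (auto simp: adjacency_matrix_def char_poly_matrix_def D_def len nth pl pinj)
  then have "det (char_poly_matrix (adjacency_matrix vs E))
      = det (mat ?n ?n (\<lambda>(i, j). transpose_mat D $$ (p i, j)))"
    by (simp add: det_transpose[where n = ?n])
  also have "\<dots> = signof p * det (transpose_mat D)"
    by (rule det_permute_rows[OF _ p0]) (use D in simp)
  also have "\<dots> = signof p * (signof p * det ?C)"
    using det_permute_rows[OF C p0, folded D_def] det_transpose[OF D] by simp
  also have "\<dots> = det ?C"
    by (simp add: sign_def)
  finally show ?thesis by (simp add: char_poly_def)
qed

text \<open>Since the adjacency matrix is real symmetric, its eigenvalues are exactly the real roots
  of its characteristic polynomial. The root multiplicities are the eigenvalue multiplicities.\<close>

definition graph_eigenvalues :: "'a set \<Rightarrow> 'a set set \<Rightarrow> real list" where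
  "graph_eigenvalues V E = rev (sorted_list_of_multiset (proots (graph_char_poly V E)))"

text \<open>Eigenvalues are numbered from \<open>1\<close>.\<close>

definition graph_eigenvalue :: "nat \<Rightarrow> 'a set \<Rightarrow> 'a set set \<Rightarrow> real" where
  "graph_eigenvalue k V E = graph_eigenvalues V E ! (k - 1)"

end

theory Submission
  imports Defs "Jordan_Normal_Form.Schur_Decomposition"
begin

text \<open>Suppose that at most \<open>t\<close> edges join \<open>S\<close> to its complement \<open>T\<close>. As \<open>t < d\<close>, both sides have at least
  \<open>d + 1\<close> vertices, and by the handshake lemma at least \<open>d + 2\<close> if the number of these edges is odd.
  Take \<open>f = p\<close> on \<open>S\<close> and \<open>f = q\<close> on \<open>T\<close>, scaled by \<open>1 - \<alpha>\<close> at the ends of cut edges.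
  By \<open>(x - y)\<^sup>2 \<le> 2 x\<^sup>2 + 2 y\<^sup>2\<close> on the cut edges, the form of \<open>A - (d - \<epsilon>)\<close> at \<open>f\<close> is at least the sum
  over the two sides of \<open>\<epsilon> \<Sum> f(u)\<^sup>2 - 2 \<Sum> c(u) f(u)\<^sup>2 - \<Sum> (f(u) - f(v))\<^sup>2\<close>, where \<open>c(u)\<close> counts the cut
  edges at \<open>u\<close> and the last sum runs over the edges inside the side. If each side has at least
  \<open>d + k - 2\<close> vertices, both summands are nonnegative for \<open>\<epsilon> D = 2 t\<close>, \<open>\<epsilon> + D = d + k\<close> and
  \<open>\<alpha> = 2 / D\<close>. As \<open>p\<close> and \<open>q\<close> are free, the second eigenvalue is at least
  \<open>d - \<epsilon> = (d - k + sqrt ((d + k)\<^sup>2 - 8 t)) / 2\<close>. The first claim is the case \<open>k = 3\<close>, the second the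
  case \<open>k = 4\<close>, where an even cut has at most \<open>t - 1\<close> edges and falls under \<open>k = 3\<close>.\<close>

section \<open>The second eigenvalue of a real symmetric matrix\<close>

text \<open>Over the complex numbers the characteristic polynomial has a root \<open>l\<close>.
  Moving the symmetric matrix across the product of an eigenvector with its conjugate gives
  \<open>l = cnj l\<close>, so \<open>l\<close> is real.\<close>

lemma symmetric_real_mat_eigenvalue_exists:
  fixes A :: "real mat"
  assumes A: "A \<in> carrier_mat n n" and sym: "transpose_mat A = A" and n: "n > 0"
  shows "\<exists>e. eigenvalue A e"
proof -
  let ?C = "map_mat complex_of_real A"
  have C: "?C \<in> carrier_mat n n" using A by simp
  have symC: "transpose_mat ?C = ?C"
    by (metis map_mat_transpose sym)
  obtain as where as: "char_poly ?C = (\<Prod>a\<leftarrow>as. [:- a, 1:])" "length as = n"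
    using char_poly_factorized[OF C] by blast
  then obtain l bs where "as = l # bs" using n by (cases as) auto
  then have root: "poly (char_poly ?C) l = 0" using as by simp
  then obtain v where "eigenvector ?C v l"
    using eigenvalue_root_char_poly[OF C] by (auto simp: eigenvalue_def)
  then have v: "v \<in> carrier_vec n" "v \<noteq> 0\<^sub>v n" and ev: "?C *\<^sub>v v = l \<cdot>\<^sub>v v"
    using C by (auto simp: eigenvector_def)
  let ?w = "conjugate v"
  have w: "?w \<in> carrier_vec n" using v by simp
  have "?C *\<^sub>v ?w = conjugate (?C *\<^sub>v v)"
    using A v by (intro eq_vecI) (auto simp: scalar_prod_def)
  then have evw: "?C *\<^sub>v ?w = cnj l \<cdot>\<^sub>v ?w"
    unfolding ev by (simp add: conjugate_smult_vec)
  have "l * (v \<bullet> ?w) = (?C *\<^sub>v v) \<bullet> ?w" using v w ev by simp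
  also have "\<dots> = v \<bullet> (?C *\<^sub>v ?w)"
    using transpose_vec_mult_scalar[OF C w v(1)] symC by simp
  also have "\<dots> = cnj l * (v \<bullet> ?w)" using v w evw by simp
  finally have "l = cnj l" using conjugate_square_eq_0_vec[OF v(1)] v(2) by simp
  then obtain r where r: "l = complex_of_real r"
    by (metis Reals_cnj_iff Reals_cases)
  have "char_poly ?C = map_poly complex_of_real (char_poly A)"
    by (rule of_real_hom.char_poly_hom[OF A])
  then have "poly (char_poly A) r = 0" using root r by simp
  then show ?thesis using eigenvalue_root_char_poly[OF A] by blast
qed

text \<open>Gram-Schmidt applied to a basis starting with \<open>v\<close> keeps \<open>v\<close> in
  front; normalizing the vectors makes \<open>W\<close> orthogonal.\<close>

lemma orthogonal_mat_with_first_col: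
  fixes v :: "real vec"
  assumes v: "v \<in> carrier_vec n" "v \<noteq> 0\<^sub>v n"
  shows "\<exists>W c. W \<in> carrier_mat n n \<and> transpose_mat W * W = 1\<^sub>m n \<and> col W 0 = c \<cdot>\<^sub>v v"
proof -
  interpret cof_vec_space n "TYPE(real)" .
  define ws where "ws = gram_schmidt n (basis_completion v)"
  note b = basis_completion[OF v]
  have len: "length ws = n" and ws: "set ws \<subseteq> carrier_vec n" and orth: "corthogonal ws"
    using gram_schmidt_result[OF b(2) b(4) b(5) ws_def] b(6) by auto
  have n: "n > 0" using v by (cases n) auto
  have "hd ws = v"
    using gram_schmidt_hd[OF v(1)] b(6) b(7) n unfolding ws_def
    by (cases "basis_completion v") auto
  then have ws0: "ws ! 0 = v" using len n by (cases ws) auto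
  define us where "us = map (\<lambda>w. (1 / sqrt (w \<bullet> w)) \<cdot>\<^sub>v w) ws"
  define W where "W = mat_of_cols n us"
  have W: "W \<in> carrier_mat n n" using mat_of_cols_carrier(1)[of n us] len by (simp add: W_def us_def)
  have wi: "ws ! i \<in> carrier_vec n" if "i < n" for i using ws len that by auto
  have colW: "col W i = (1 / sqrt (ws ! i \<bullet> ws ! i)) \<cdot>\<^sub>v ws ! i" if "i < n" for i
    using that wi len by (simp add: W_def us_def col_mat_of_cols)
  have cj: "conjugate w = w" for w :: "real vec" by (rule eq_vecI) auto
  have dot: "(ws ! i \<bullet> ws ! j = 0) = (i \<noteq> j)" if "i < n" "j < n" for i j
    using corthogonalD[OF orth] that len cj by simp
  have pos: "ws ! i \<bullet> ws ! i > 0" if "i < n" for i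
  proof -
    have "ws ! i \<bullet> ws ! i \<ge> 0" by (simp add: scalar_prod_def sum_nonneg)
    then show ?thesis using dot[OF that that] by linarith
  qed
  have "transpose_mat W * W = 1\<^sub>m n"
  proof (rule eq_matI)
    fix i j assume "i < dim_row (1\<^sub>m n)" "j < dim_col (1\<^sub>m n)"
    then have ij: "i < n" "j < n" by auto
    have "(transpose_mat W * W) $$ (i, j) = col W i \<bullet> col W j" using W ij by simp
    also have "\<dots> = (1 / sqrt (ws ! i \<bullet> ws ! i)) * ((1 / sqrt (ws ! j \<bullet> ws ! j)) * (ws ! i \<bullet> ws ! j))"
      using wi[OF ij(1)] wi[OF ij(2)] ij
      by (simp add: colW smult_scalar_prod_distrib[of _ n] scalar_prod_smult_distrib[of _ n])
    also have "\<dots> = (1\<^sub>m n) $$ (i, j)"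
      using dot[OF ij] pos[of i] ij by (auto simp: divide_simps)
    finally show "(transpose_mat W * W) $$ (i, j) = (1\<^sub>m n) $$ (i, j)" .
  qed (use W in auto)
  then show ?thesis using W colW[OF n] ws0 by auto
qed

text \<open>Deflation: in an orthonormal basis starting with an eigenvector, the matrix splits by
  symmetry into the eigenvalue and a smaller symmetric block \<open>A3\<close>, to which the
  induction hypothesis applies.\<close>

theorem symmetric_real_mat_diagonalization:
  fixes A :: "real mat"
  assumes "A \<in> carrier_mat n n" and "transpose_mat A = A"
  shows "\<exists>U f. U \<in> carrier_mat n n \<and> transpose_mat U * U = 1\<^sub>m n
    \<and> transpose_mat U * A * U = mat_diag n f"
  using assms
proof (induction n arbitrary: A)
  case 0
  then show ?case by (intro exI[of _ "1\<^sub>m 0"] exI[of _ "\<lambda>_. 0"]) (auto simp: mat_diag_def)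
next
  case (Suc m)
  let ?n = "Suc m"
  note A = Suc.prems(1)
  obtain e v where "eigenvector A v e"
    using symmetric_real_mat_eigenvalue_exists[OF Suc.prems] by (auto simp: eigenvalue_def)
  then have v: "v \<in> carrier_vec ?n" "v \<noteq> 0\<^sub>v ?n" and ev: "A *\<^sub>v v = e \<cdot>\<^sub>v v"
    using A by (auto simp: eigenvector_def)
  obtain W c where W: "W \<in> carrier_mat ?n ?n" "transpose_mat W * W = 1\<^sub>m ?n" "col W 0 = c \<cdot>\<^sub>v v"
    using orthogonal_mat_with_first_col[OF v] by blast
  let ?T = "transpose_mat W"
  have T: "?T \<in> carrier_mat ?n ?n" using W by simp
  define B where "B = ?T * A * W"
  have B: "B \<in> carrier_mat ?n ?n" using A W by (simp add: B_def)
  have symB: "transpose_mat B = B"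
    using A W T Suc.prems(2) by (simp add: B_def transpose_mult[of _ ?n ?n _ ?n] assoc_mult_mat[of _ ?n ?n _ ?n _ ?n])
  \<comment> \<open>The first column of \<open>W\<close> is an eigenvector, so the first column of
    \<open>B\<close> is \<open>e\<close> times that of \<open>?T * W\<close>, the identity.\<close>
  have B0: "B $$ (i, 0) = (if i = 0 then e else 0)" if "i < ?n" for i
  proof -
    have "B $$ (i, 0) = (?T * (A * W)) $$ (i, 0)"
      using A W T by (simp add: B_def assoc_mult_mat[of _ ?n ?n _ ?n _ ?n])
    also have "\<dots> = col W i \<bullet> (A *\<^sub>v col W 0)"
      using that A W(1) by (simp add: mult_mat_vec_def)
    also have "A *\<^sub>v col W 0 = e \<cdot>\<^sub>v col W 0"
      using A v ev by (simp add: W(3) mult_mat_vec smult_smult_assoc mult.commute)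
    also have "col W i \<bullet> (e \<cdot>\<^sub>v col W 0) = e * (?T * W) $$ (i, 0)"
      using that W(1) by simp
    finally show ?thesis using that by (simp add: W(2))
  qed
  have B0': "B $$ (0, i) = (if i = 0 then e else 0)" if "i < ?n" for i
    using B0[OF that] B symB that by (metis carrier_matD index_transpose_mat(1) zero_less_Suc)
  define A3 where "A3 = mat m m (\<lambda>(i, j). B $$ (Suc i, Suc j))"
  have A3: "A3 \<in> carrier_mat m m" by (simp add: A3_def)
  have symA3: "transpose_mat A3 = A3"
  proof (rule eq_matI)
    fix i j assume "i < dim_row A3" "j < dim_col A3"
    then show "transpose_mat A3 $$ (i, j) = A3 $$ (i, j)"
      using arg_cong[OF symB, of "\<lambda>M. M $$ (Suc i, Suc j)"] B by (simp add: A3_def)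
  qed (auto simp: A3_def)
  obtain U f where U: "U \<in> carrier_mat m m" "transpose_mat U * U = 1\<^sub>m m"
    and diag: "transpose_mat U * A3 * U = mat_diag m f"
    using Suc.IH[OF A3 symA3] by blast
  let ?E = "mat 1 1 (\<lambda>_. e)"
  let ?Z = "four_block_mat (1\<^sub>m 1) (0\<^sub>m 1 m) (0\<^sub>m m 1) U"
  have Bblock: "B = four_block_mat ?E (0\<^sub>m 1 m) (0\<^sub>m m 1) A3"
  proof (rule eq_matI)
    fix i j assume "i < dim_row (four_block_mat ?E (0\<^sub>m 1 m) (0\<^sub>m m 1) A3)"
      "j < dim_col (four_block_mat ?E (0\<^sub>m 1 m) (0\<^sub>m m 1) A3)"
    then have "i < ?n" "j < ?n" using A3 by auto
    then show "B $$ (i, j) = four_block_mat ?E (0\<^sub>m 1 m) (0\<^sub>m m 1) A3 $$ (i, j)"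
      using B0 B0' by (cases i; cases j) (auto simp: A3_def)
  qed (use A3 B in auto)
  have Z: "?Z \<in> carrier_mat ?n ?n" using U by (metis four_block_carrier_mat one_carrier_mat plus_1_eq_Suc)
  have ZT: "transpose_mat ?Z = four_block_mat (1\<^sub>m 1) (0\<^sub>m 1 m) (0\<^sub>m m 1) (transpose_mat U)"
    using U by (subst transpose_four_block_mat[of _ 1 1 _ m _ m]) auto
  have ZZ: "transpose_mat ?Z * ?Z = 1\<^sub>m ?n"
    unfolding ZT using U
    by (subst mult_four_block_mat[of _ 1 1 _ m _ m _ _ 1 _ m]) (auto simp: one_mat_def[of ?n] intro!: eq_matI)
  have EB: "transpose_mat ?Z * B * ?Z = four_block_mat ?E (0\<^sub>m 1 m) (0\<^sub>m m 1) (transpose_mat U * A3 * U)"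
    unfolding ZT Bblock using U A3
    by (simp add: mult_four_block_mat[of _ 1 1 _ m _ m _ _ 1 _ m])
  have D: "transpose_mat ?Z * B * ?Z = mat_diag ?n (\<lambda>i. case i of 0 \<Rightarrow> e | Suc k \<Rightarrow> f k)"
    unfolding EB diag by (rule eq_matI) (auto simp: mat_diag_def split: nat.split)
  let ?U = "W * ?Z"
  have UT: "transpose_mat ?U = transpose_mat ?Z * ?T"
    by (rule transpose_mult[OF W(1) Z])
  have ZT': "transpose_mat ?Z \<in> carrier_mat ?n ?n" using Z by simp
  have "transpose_mat ?U * ?U = transpose_mat ?Z * (?T * W) * ?Z"
    unfolding UT using W(1) T Z ZT' by (simp add: assoc_mult_mat[of _ ?n ?n _ ?n _ ?n] del: transpose_carrier_mat)
  then have 1: "transpose_mat ?U * ?U = 1\<^sub>m ?n"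
    unfolding W(2) using ZZ right_mult_one_mat[OF ZT'] by simp
  have "transpose_mat ?U * A * ?U = transpose_mat ?Z * B * ?Z"
    unfolding UT B_def using W(1) T Z ZT' A by (simp add: assoc_mult_mat[of _ ?n ?n _ ?n _ ?n])
  then show ?case using 1 D W(1) Z
    by (intro exI[of _ ?U] exI[of _ "\<lambda>i. case i of 0 \<Rightarrow> e | Suc k \<Rightarrow> f k"]) auto
qed

lemma proots_char_poly_diagonalization:
  fixes A :: "real mat"
  assumes A: "A \<in> carrier_mat n n" and U: "U \<in> carrier_mat n n" "transpose_mat U * U = 1\<^sub>m n"
    and diag: "transpose_mat U * A * U = mat_diag n f"
  shows "proots (char_poly A) = mset (map f [0..<n])"
proof -
  let ?T = "transpose_mat U"
  have T: "?T \<in> carrier_mat n n" using U by simp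
  have UT: "U * ?T = 1\<^sub>m n" by (rule mat_mult_left_right_inverse[OF T U])
  have "similar_mat_wit (mat_diag n f) A ?T U"
    using A U T UT diag by (intro similar_mat_witI[of _ _ n]) (auto simp: mat_diag_def)
  then have "char_poly A = char_poly (mat_diag n f)"
    by (metis char_poly_similar similar_mat_def)
  also have "\<dots> = (\<Prod>a\<leftarrow>diag_mat (mat_diag n f). [:- a, 1:])"
    by (rule char_poly_upper_triangular[of _ n]) (auto simp: mat_diag_def)
  also have "diag_mat (mat_diag n f) = map f [0..<n]"
    by (auto simp: diag_mat_def mat_diag_def)
  finally have cp: "char_poly A = (\<Prod>a\<leftarrow>map f [0..<n]. [:- a, 1:])" .
  have "proots (\<Prod>a\<leftarrow>xs. [:- a, 1:]) = mset xs" for xs :: "real list"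
  proof (induction xs)
    case (Cons x xs)
    have "(\<Prod>a\<leftarrow>xs. [:- a, 1:]) \<noteq> 0"
      by (auto simp: prod_list_zero_iff)
    then show ?case using Cons by (simp add: proots_mult del: mult_pCons_left)
  qed simp
  then show ?thesis unfolding cp by blast
qed

section \<open>Bounding the second largest eigenvalue from a plane\<close>

text \<open>Distinct indices count separately even when \<open>f i = f j\<close>, so at least two
  list entries reach \<theta>; in non-increasing order these include the entry at index
  \<open>1\<close>.\<close>

lemma second_largest_ge:
  fixes f :: "nat \<Rightarrow> real"
  assumes "i < n" "j < n" "i \<noteq> j" "f i \<ge> \<theta>" "f j \<ge> \<theta>"
  shows "rev (sorted_list_of_multiset (mset (map f [0..<n]))) ! 1 \<ge> \<theta>"
proof -
  define xs where "xs = rev (sorted_list_of_multiset (mset (map f [0..<n])))"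
  have mset: "mset xs = mset (map f [0..<n])" by (simp add: xs_def)
  have sorted: "sorted (rev xs)" by (simp add: xs_def)
  have "mset [i, j] \<subseteq># mset [0..<n]"
    using subset_imp_msubset_mset_set[of "{i, j}" "{0..<n}"] assms(1-3) by simp
  then have "filter_mset (\<lambda>x. x \<ge> \<theta>) (image_mset f (mset [i, j])) \<subseteq># filter_mset (\<lambda>x. x \<ge> \<theta>) (mset xs)"
    unfolding mset by (metis image_mset_subseteq_mono mset_map multiset_filter_mono)
  then have "2 \<le> size (filter_mset (\<lambda>x. x \<ge> \<theta>) (mset xs))"
    using size_mset_mono assms by fastforce
  then have "2 \<le> length (filter (\<lambda>x. x \<ge> \<theta>) xs)"
    by (metis mset_filter size_mset)
  then obtain a b ys where xs: "xs = a # b # ys"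
    by (metis One_nat_def Suc_1 filter.simps(1) le_zero_eq length_0_conv length_Cons length_filter_le
        list.exhaust list.size(3) not_less_eq_eq order_trans zero_neq_numeral)
  have "b \<ge> \<theta>"
  proof (rule ccontr)
    assume "\<not> b \<ge> \<theta>"
    then have "\<forall>y\<in>set (b # ys). \<not> y \<ge> \<theta>"
      using sorted unfolding xs by (auto simp: sorted_append)
    then have "filter (\<lambda>x. x \<ge> \<theta>) (b # ys) = []" by (metis filter_False)
    then have "length (filter (\<lambda>x. x \<ge> \<theta>) xs) \<le> 1" unfolding xs by simp
    then show False using \<open>2 \<le> length (filter (\<lambda>x. x \<ge> \<theta>) xs)\<close> by linarith
  qed
  then show ?thesis using xs by (simp add: xs_def)
qed

text \<open>One half of the Courant-Fischer principle: if at most one eigenvalue reached \<theta>,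
  the plane spanned by \<open>u\<close> and \<open>w\<close> would contain a nonzero vector
  orthogonal to its eigenvector, and there the form is strictly below \<theta> times the squared
  norm.\<close>

theorem second_eigenvalue_ge:
  fixes A :: "real mat"
  assumes A: "A \<in> carrier_mat n n" "transpose_mat A = A"
    and u: "u \<in> carrier_vec n" and w: "w \<in> carrier_vec n"
    and indep: "\<And>p q. p \<noteq> 0 \<or> q \<noteq> 0 \<Longrightarrow> p \<cdot>\<^sub>v u + q \<cdot>\<^sub>v w \<noteq> 0\<^sub>v n"
    and form: "\<And>p q x. x = p \<cdot>\<^sub>v u + q \<cdot>\<^sub>v w \<Longrightarrow> \<theta> * (x \<bullet> x) \<le> x \<bullet> (A *\<^sub>v x)"
  shows "rev (sorted_list_of_multiset (proots (char_poly A))) ! 1 \<ge> \<theta>"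
proof -
  obtain U f where U: "U \<in> carrier_mat n n" "transpose_mat U * U = 1\<^sub>m n"
    and diag: "transpose_mat U * A * U = mat_diag n f"
    using symmetric_real_mat_diagonalization[OF A] by blast
  let ?T = "transpose_mat U"
  have T: "?T \<in> carrier_mat n n" using U by simp
  have UT: "U * ?T = 1\<^sub>m n" by (rule mat_mult_left_right_inverse[OF T U])
  have n: "n > 0" using indep[of 1 0] u w by (cases n) auto
  have "\<exists>i j. i < n \<and> j < n \<and> i \<noteq> j \<and> f i \<ge> \<theta> \<and> f j \<ge> \<theta>"
  proof (rule ccontr)
    assume neg: "\<not> ?thesis"
    \<comment> \<open>If no \<open>f j\<close> reaches \<theta>, any index serves as
      \<open>k\<close>.\<close>
    obtain k where k: "k < n" "\<And>j. j < n \<Longrightarrow> j \<noteq> k \<Longrightarrow> f j < \<theta>"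
      using neg n by (metis not_le)
    define a b where "a = (?T *\<^sub>v u) $ k" and "b = (?T *\<^sub>v w) $ k"
    \<comment> \<open>A nontrivial combination whose coordinate \<open>k\<close> in the eigenbasis
      vanishes: \<open>(b, -a)\<close>, or \<open>(1, 0)\<close> if \<open>a = 0\<close>.\<close>
    define p q where "p = (if a = 0 then 1 else b)" and "q = (if a = 0 then 0 else - a)"
    have pq: "p \<noteq> 0 \<or> q \<noteq> 0" "p * a + q * b = 0" by (auto simp: p_def q_def)
    define x where "x = p \<cdot>\<^sub>v u + q \<cdot>\<^sub>v w"
    have x: "x \<in> carrier_vec n" "x \<noteq> 0\<^sub>v n"
      using indep pq(1) u w by (auto simp: x_def)
    define y where "y = ?T *\<^sub>v x"
    have y: "y \<in> carrier_vec n" using x T by (simp add: y_def)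
    have "y = p \<cdot>\<^sub>v (?T *\<^sub>v u) + q \<cdot>\<^sub>v (?T *\<^sub>v w)"
      using T u w by (simp add: y_def x_def mult_add_distrib_mat_vec mult_mat_vec)
    then have yk: "y $ k = 0" using pq(2) k(1) T u w by (simp add: a_def b_def)
    have xy: "x = U *\<^sub>v y"
      using assoc_mult_mat_vec[OF U(1) T x(1)] UT x by (simp add: y_def)
    have xx: "x \<bullet> x = y \<bullet> y"
      using transpose_vec_mult_scalar[OF U(1) y x(1)] xy y_def by metis
    have "A *\<^sub>v x = A *\<^sub>v (U *\<^sub>v y)" using xy by simp
    then have Dy: "?T *\<^sub>v (A *\<^sub>v x) = mat_diag n f *\<^sub>v y"
      using A U T y by (simp add: diag[symmetric] assoc_mult_mat_vec[of _ n n _ n])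
    have "x \<bullet> (A *\<^sub>v x) = (A *\<^sub>v x) \<bullet> (U *\<^sub>v y)"
      using comm_scalar_prod[of x n "A *\<^sub>v x"] x A xy by simp
    also have "\<dots> = (?T *\<^sub>v (A *\<^sub>v x)) \<bullet> y"
      by (rule transpose_vec_mult_scalar[OF U(1) y, symmetric]) (use A x in simp)
    finally have xAx: "x \<bullet> (A *\<^sub>v x) = (\<Sum>i<n. f i * (y $ i)\<^sup>2)"
      unfolding Dy using y
      by (auto simp: scalar_prod_def mat_diag_def power2_eq_square if_distrib[of "\<lambda>z. z * _"]
          sum.delta atLeast0LessThan cong: if_cong intro!: sum.cong)
    have yy: "y \<bullet> y = (\<Sum>i<n. (y $ i)\<^sup>2)"
      using y by (simp add: scalar_prod_def power2_eq_square atLeast0LessThan)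
    have "\<exists>j<n. y $ j \<noteq> 0"
    proof (rule ccontr)
      assume "\<not> ?thesis"
      then have "y = 0\<^sub>v n" using y by (intro eq_vecI) auto
      then show False using x xy U by auto
    qed
    then obtain j where j: "j < n" "y $ j \<noteq> 0" by blast
    then have "j \<noteq> k" using yk by auto
    have "(\<Sum>i<n. f i * (y $ i)\<^sup>2) < (\<Sum>i<n. \<theta> * (y $ i)\<^sup>2)"
    proof (rule sum_strict_mono_ex1)
      show "\<forall>i\<in>{..<n}. f i * (y $ i)\<^sup>2 \<le> \<theta> * (y $ i)\<^sup>2"
        using k yk by (metis lessThan_iff less_imp_le mult_right_mono mult_zero_right order_refl
            power_zero_numeral zero_le_power2)
      show "\<exists>i\<in>{..<n}. f i * (y $ i)\<^sup>2 < \<theta> * (y $ i)\<^sup>2"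
        using j k(2)[OF j(1) \<open>j \<noteq> k\<close>] by (intro bexI[of _ j]) auto
    qed simp
    then have "x \<bullet> (A *\<^sub>v x) < \<theta> * (x \<bullet> x)"
      by (simp add: xAx xx yy sum_distrib_left)
    then show False using form[OF x_def] by linarith
  qed
  then show ?thesis
    unfolding proots_char_poly_diagonalization[OF A(1) U diag] using second_largest_ge by blast
qed

section \<open>The quadratic form of the test functions\<close>

text \<open>The expression is the quadratic form of the header at the test function, on a side with
  \<open>a\<close> vertices, \<open>e\<close> cut edges and \<open>b\<close> ends of cut edges, all \<open>b * (a - b)\<close> pairs being counted as
  edges. It vanishes for \<open>a = D + \<epsilon> - 2\<close> and \<open>b = e = \<epsilon> * D / 2\<close>.\<close>

lemma side_form_nonneg:
  fixes a b e D \<epsilon> \<alpha> :: real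
  assumes "D \<ge> 2" "\<epsilon> > 0" "\<alpha> = 2 / D" "a \<ge> D + \<epsilon> - 2" "0 \<le> b" "b \<le> e" "2 * e \<le> \<epsilon> * D"
  shows "\<epsilon> * ((a - b) + b * (1 - \<alpha>)\<^sup>2) - 2 * (e * (1 - \<alpha>)\<^sup>2) - \<alpha>\<^sup>2 * (b * (a - b)) \<ge> 0"
proof -
  have aD: "\<alpha> * D = 2" and \<alpha>: "0 < \<alpha>" "\<alpha> \<le> 1" using assms by auto
  have "\<alpha> * (2 * e) \<le> \<alpha> * (\<epsilon> * D)" using assms \<alpha> by (intro mult_left_mono) auto
  also have "\<dots> = 2 * \<epsilon>" using aD by (metis mult.assoc mult.commute)
  finally have ae: "\<alpha> * e \<le> \<epsilon>" by simp
  have ab: "\<alpha> * b \<le> \<epsilon>" using ae mult_left_mono[of b e \<alpha>] assms \<alpha> by linarith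
  have "\<alpha>\<^sup>2 * b \<le> \<epsilon>"
  proof -
    have "\<alpha> * (\<alpha> * b) \<le> 1 * (\<alpha> * b)" using \<alpha> assms by (intro mult_right_mono) auto
    then show ?thesis using ab by (simp add: power2_eq_square mult.assoc)
  qed
  \<comment> \<open>The expression is affine in \<open>a\<close> with slope
    \<open>\<epsilon> - \<alpha>\<^sup>2 * b\<close>, so the smallest admissible \<open>a\<close> is
    the worst case.\<close>
  then have "(\<epsilon> - \<alpha>\<^sup>2 * b) * (a - (D + \<epsilon> - 2)) \<ge> 0" using assms by simp
  \<comment> \<open>The value at \<open>a = D + \<epsilon> - 2\<close>, written as nonnegative terms
    and a last one that vanishes because \<open>\<alpha> * D = 2\<close>.\<close>
  moreover have "\<epsilon> * ((a - b) + b * (1 - \<alpha>)\<^sup>2) - 2 * (e * (1 - \<alpha>)\<^sup>2) - \<alpha>\<^sup>2 * (b * (a - b))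
     - (\<epsilon> - \<alpha>\<^sup>2 * b) * (a - (D + \<epsilon> - 2))
     = (e - b) * (\<alpha> * (\<epsilon> - \<alpha> * e) + \<alpha> * (\<epsilon> - \<alpha> * b) + 2 * \<alpha> * (1 - \<alpha>))
      + (\<epsilon> - \<alpha> * e) * (D - 2) + (\<epsilon> - \<alpha> * e)\<^sup>2 + (\<alpha> * D - 2) * (e - \<alpha> * b)"
    by (simp add: algebra_simps power2_eq_square)
  moreover have "(e - b) * (\<alpha> * (\<epsilon> - \<alpha> * e) + \<alpha> * (\<epsilon> - \<alpha> * b) + 2 * \<alpha> * (1 - \<alpha>)) \<ge> 0"
    using assms \<alpha> ae ab by (intro mult_nonneg_nonneg add_nonneg_nonneg) auto
  moreover have "(\<epsilon> - \<alpha> * e) * (D - 2) \<ge> 0"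
    using assms ae by simp
  ultimately show ?thesis using aD by (smt (verit) zero_le_power2 mult_eq_0_iff)
qed

lemma sum_sum_square_diff:
  fixes g :: "'a \<Rightarrow> real"
  shows "(\<Sum>u\<in>S. \<Sum>v\<in>S. (g u - g v)\<^sup>2) = 2 * (card S * (\<Sum>u\<in>S. (g u)\<^sup>2)) - 2 * (\<Sum>u\<in>S. g u)\<^sup>2"
proof -
  have "(\<Sum>u\<in>S. \<Sum>v\<in>S. (g u - g v)\<^sup>2) = (\<Sum>u\<in>S. \<Sum>v\<in>S. (g u)\<^sup>2 + (g v)\<^sup>2 - 2 * (g u * g v))"
    by (simp add: power2_diff mult.assoc)
  also have "\<dots> = 2 * (card S * (\<Sum>u\<in>S. (g u)\<^sup>2)) - 2 * ((\<Sum>u\<in>S. g u) * (\<Sum>v\<in>S. g v))"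
    by (simp add: sum.distrib sum_subtractf sum_distrib_left[symmetric] sum_product)
  finally show ?thesis by (simp add: power2_eq_square)
qed

text \<open>As \<open>g\<close> takes two values, all sums reduce to the counts in
  \<open>side_form_nonneg\<close>. Only pairs between \<open>B\<close> and \<open>S - B\<close>
  contribute to the last sum, and \<open>c u \<ge> 1\<close> on \<open>B\<close> gives
  \<open>?b \<le> ?e\<close>.\<close>

lemma two_valued_side_form_nonneg:
  fixes D \<epsilon> \<alpha> :: real and c g :: "'a \<Rightarrow> real" and w :: "'a \<Rightarrow> 'a \<Rightarrow> real"
  assumes fin: "finite S" and D: "D \<ge> 2" "\<epsilon> > 0" "\<alpha> = 2 / D" "card S \<ge> D + \<epsilon> - 2"
    and c: "\<And>u. u \<in> S \<Longrightarrow> c u = 0 \<or> c u \<ge> 1" "2 * (\<Sum>u\<in>S. c u) \<le> \<epsilon> * D"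
    and w: "\<And>u v. w u v \<le> 1"
    and g: "\<And>u. g u = (if c u = 0 then 1 else 1 - \<alpha>)"
  shows "\<epsilon> * (\<Sum>u\<in>S. (g u)\<^sup>2) - 2 * (\<Sum>u\<in>S. c u * (g u)\<^sup>2)
    - (\<Sum>u\<in>S. \<Sum>v\<in>S. w u v * (g u - g v)\<^sup>2) / 2 \<ge> 0"
proof -
  define B where "B = {u \<in> S. c u \<noteq> 0}"
  have B: "finite B" "B \<subseteq> S" using fin by (auto simp: B_def)
  let ?a = "real (card S)" and ?b = "real (card B)" and ?e = "\<Sum>u\<in>S. c u"
  have split: "(\<Sum>u\<in>S. h (g u)) = (?a - ?b) * h 1 + ?b * h (1 - \<alpha>)" for h :: "real \<Rightarrow> real"
  proof -
    have "(\<Sum>u\<in>S. h (g u)) = (\<Sum>u\<in>S - B. h (g u)) + (\<Sum>u\<in>B. h (g u))"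
      by (rule sum.subset_diff[OF B(2) fin])
    also have "(\<Sum>u\<in>S - B. h (g u)) = (\<Sum>u\<in>S - B. h 1)"
      by (rule sum.cong) (auto simp: B_def g)
    also have "(\<Sum>u\<in>B. h (g u)) = (\<Sum>u\<in>B. h (1 - \<alpha>))"
      by (rule sum.cong) (auto simp: B_def g)
    finally show ?thesis
      using B fin by (simp add: card_Diff_subset of_nat_diff card_mono)
  qed
  have g2: "(\<Sum>u\<in>S. (g u)\<^sup>2) = (?a - ?b) + ?b * (1 - \<alpha>)\<^sup>2"
    using split[of "\<lambda>x. x\<^sup>2"] by simp
  have g1: "(\<Sum>u\<in>S. g u) = (?a - ?b) + ?b * (1 - \<alpha>)"
    using split[of "\<lambda>x. x"] by simp
  have cg: "(\<Sum>u\<in>S. c u * (g u)\<^sup>2) = ?e * (1 - \<alpha>)\<^sup>2"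
    by (auto simp: g sum_distrib_right intro!: sum.cong)
  have "(\<Sum>u\<in>S. \<Sum>v\<in>S. w u v * (g u - g v)\<^sup>2) \<le> (\<Sum>u\<in>S. \<Sum>v\<in>S. 1 * (g u - g v)\<^sup>2)"
    by (intro sum_mono mult_right_mono w) auto
  \<comment> \<open>Every pair between \<open>B\<close> and \<open>S - B\<close> occurs in both
    orders, whence the factor 2.\<close>
  also have "\<dots> = 2 * (\<alpha>\<^sup>2 * (?b * (?a - ?b)))"
    by (simp add: sum_sum_square_diff g1 g2) (simp add: algebra_simps power2_eq_square)
  finally have wg: "(\<Sum>u\<in>S. \<Sum>v\<in>S. w u v * (g u - g v)\<^sup>2) / 2 \<le> \<alpha>\<^sup>2 * (?b * (?a - ?b))"
    by simp
  have "?b = (\<Sum>u\<in>B. 1)" by simp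
  also have "\<dots> \<le> (\<Sum>u\<in>B. c u)"
    using c(1) by (intro sum_mono) (auto simp: B_def)
  also have "\<dots> \<le> ?e"
    using c(1) fin B by (intro sum_mono2) force+
  finally have "?b \<le> ?e" .
  then show ?thesis
    using side_form_nonneg[OF D _ _ c(2), of ?b] wg unfolding g2 cg by simp
qed

text \<open>By regularity the form is \<open>d\<close> times the squared norm minus half the sum of
  \<open>w u v * (f u - f v)\<^sup>2\<close> over ordered pairs. Splitting the square on cut pairs
  leaves terms that involve one side each, so \<open>f\<close> can later be scaled independently on
  \<open>S\<close> and \<open>T\<close>.\<close>

lemma adjacency_form_cut_bound:
  fixes w :: "'a \<Rightarrow> 'a \<Rightarrow> real" and f :: "'a \<Rightarrow> real"
  assumes fin: "finite S" "finite T" and disj: "S \<inter> T = {}"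
    and sym: "\<And>u v. w u v = w v u" and nonneg: "\<And>u v. w u v \<ge> 0"
    and reg: "\<And>u. u \<in> S \<union> T \<Longrightarrow> (\<Sum>v\<in>S \<union> T. w u v) = d"
  shows "(\<Sum>u\<in>S \<union> T. \<Sum>v\<in>S \<union> T. w u v * f u * f v) \<ge> d * (\<Sum>u\<in>S \<union> T. (f u)\<^sup>2)
    - (2 * (\<Sum>u\<in>S. (\<Sum>v\<in>T. w u v) * (f u)\<^sup>2) + (\<Sum>u\<in>S. \<Sum>v\<in>S. w u v * (f u - f v)\<^sup>2) / 2)
    - (2 * (\<Sum>u\<in>T. (\<Sum>v\<in>S. w u v) * (f u)\<^sup>2) + (\<Sum>u\<in>T. \<Sum>v\<in>T. w u v * (f u - f v)\<^sup>2) / 2)"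
proof -
  define V where "V = S \<union> T"
  have 1: "(\<Sum>u\<in>V. \<Sum>v\<in>V. w u v * (f u)\<^sup>2) = d * (\<Sum>u\<in>V. (f u)\<^sup>2)"
    using reg by (simp add: V_def sum_distrib_right[symmetric] sum_distrib_left)
  have 2: "(\<Sum>u\<in>V. \<Sum>v\<in>V. w u v * (f v)\<^sup>2) = d * (\<Sum>u\<in>V. (f u)\<^sup>2)"
    by (subst sum.swap, subst sym) (rule 1)
  have "(\<Sum>u\<in>V. \<Sum>v\<in>V. w u v * (f u - f v)\<^sup>2)
      = (\<Sum>u\<in>V. \<Sum>v\<in>V. w u v * (f u)\<^sup>2 + w u v * (f v)\<^sup>2 - 2 * (w u v * f u * f v))"
    by (simp add: power2_diff algebra_simps)
  also have "\<dots> = 2 * (d * (\<Sum>u\<in>V. (f u)\<^sup>2)) - 2 * (\<Sum>u\<in>V. \<Sum>v\<in>V. w u v * f u * f v)"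
    by (simp add: sum.distrib sum_subtractf sum_distrib_left[symmetric] 1 2)
  finally have dirichlet: "(\<Sum>u\<in>V. \<Sum>v\<in>V. w u v * (f u - f v)\<^sup>2)
      = 2 * (d * (\<Sum>u\<in>V. (f u)\<^sup>2)) - 2 * (\<Sum>u\<in>V. \<Sum>v\<in>V. w u v * f u * f v)" .
  let ?h = "\<lambda>u v. w u v * (f u - f v)\<^sup>2"
  have "(\<Sum>u\<in>T. \<Sum>v\<in>S. ?h u v) = (\<Sum>u\<in>S. \<Sum>v\<in>T. ?h u v)"
    by (subst sum.swap) (simp add: sym power2_commute)
  then have parts: "(\<Sum>u\<in>V. \<Sum>v\<in>V. ?h u v) = (\<Sum>u\<in>S. \<Sum>v\<in>S. ?h u v) + (\<Sum>u\<in>T. \<Sum>v\<in>T. ?h u v)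
      + 2 * (\<Sum>u\<in>S. \<Sum>v\<in>T. ?h u v)"
    using fin disj by (simp add: V_def sum.union_disjoint sum.distrib)
  have "(\<Sum>u\<in>S. \<Sum>v\<in>T. ?h u v) \<le> (\<Sum>u\<in>S. \<Sum>v\<in>T. 2 * (w u v * (f u)\<^sup>2) + 2 * (w u v * (f v)\<^sup>2))"
  proof (intro sum_mono)
    fix u v
    have "(f u - f v)\<^sup>2 \<le> 2 * (f u)\<^sup>2 + 2 * (f v)\<^sup>2"
      using zero_le_power2[of "f u + f v"] by (simp add: power2_sum power2_diff)
    then show "?h u v \<le> 2 * (w u v * (f u)\<^sup>2) + 2 * (w u v * (f v)\<^sup>2)"
      using mult_left_mono[OF _ nonneg[of u v]] by (fastforce simp: algebra_simps)
  qed
  also have "\<dots> = 2 * (\<Sum>u\<in>S. (\<Sum>v\<in>T. w u v) * (f u)\<^sup>2) + 2 * (\<Sum>u\<in>S. \<Sum>v\<in>T. w u v * (f v)\<^sup>2)"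
    by (simp add: sum.distrib sum_distrib_left[symmetric] sum_distrib_right)
  also have "(\<Sum>u\<in>S. \<Sum>v\<in>T. w u v * (f v)\<^sup>2) = (\<Sum>v\<in>T. (\<Sum>u\<in>S. w v u) * (f v)\<^sup>2)"
    by (subst sum.swap) (simp add: sym sum_distrib_right)
  finally show ?thesis using dirichlet parts unfolding V_def by argo
qed

section \<open>Small cuts of regular graphs\<close>

text \<open>The handshake argument: every pair is counted in both orders and the diagonal
  contributes nothing.\<close>

lemma even_sum_sum_symmetric:
  fixes w :: "'a \<Rightarrow> 'a \<Rightarrow> nat"
  assumes "finite S" "\<And>u v. w u v = w v u" "\<And>u. w u u = 0"
  shows "even (\<Sum>u\<in>S. \<Sum>v\<in>S. w u v)"
  using assms(1)
proof (induction S)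
  case (insert x S)
  have "(\<Sum>u\<in>insert x S. \<Sum>v\<in>insert x S. w u v) = 2 * (\<Sum>v\<in>S. w x v) + (\<Sum>u\<in>S. \<Sum>v\<in>S. w u v)"
    using insert(1,2) assms(2)[of _ x] assms(3) by (simp add: sum.distrib)
  then show ?case using insert.IH by simp
qed simp

text \<open>The value type is left open: the indicator counts edges in \<open>nat\<close> and is a
  weight of the quadratic form in \<open>real\<close>.\<close>

abbreviation adj :: "'a set set \<Rightarrow> 'a \<Rightarrow> 'a \<Rightarrow> 'b::zero_neq_one" where
  "adj E u v \<equiv> of_bool ({u, v} \<in> E)"

text \<open>Each cut edge is counted once, from its end in \<open>S\<close>. The double sum has the
  shape of the sums in the quadratic form.\<close>

definition cut_size :: "'a set \<Rightarrow> 'a set set \<Rightarrow> 'a set \<Rightarrow> nat" where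
  "cut_size V E S = (\<Sum>u\<in>S. \<Sum>v\<in>V - S. adj E u v)"

lemma cut_size_complement:
  assumes "S \<subseteq> V"
  shows "cut_size V E (V - S) = cut_size V E S"
  unfolding cut_size_def double_diff[OF assms order_refl]
  by (subst sum.swap) (simp add: insert_commute)

lemma (in simple_graph) no_loop: "{u} \<notin> E"
  using edges[of "{u}"] by auto

lemma (in simple_graph) sum_adj_eq_degree: "(\<Sum>v\<in>V. adj E u v) = vertex_degree E u"
proof -
  have "bij_betw (\<lambda>v. {u, v}) {v \<in> V. {u, v} \<in> E} {e \<in> E. u \<in> e}"
  proof (rule bij_betwI')
    fix e assume e: "e \<in> {e \<in> E. u \<in> e}"
    then obtain x y where "e = {x, y}" using edges[of e] by (auto simp: card_2_iff)
    then show "\<exists>v\<in>{v \<in> V. {u, v} \<in> E}. e = {u, v}"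
      using e edges[of e] by (auto simp: insert_commute)
  qed (auto simp: doubleton_eq_iff)
  then have "card {v \<in> V. {u, v} \<in> E} = vertex_degree E u"
    unfolding vertex_degree_def by (rule bij_betw_same_card)
  then show ?thesis
    using finite_vertices by (simp add: of_bool_def sum.If_cases Int_def)
qed

lemma (in simple_graph) degree_sum_side:
  assumes "regular d V E" "S \<subseteq> V"
  shows "card S * d = (\<Sum>u\<in>S. \<Sum>v\<in>S. adj E u v) + cut_size V E S"
proof -
  have "card S * d = (\<Sum>u\<in>S. \<Sum>v\<in>V. adj E u v)"
    using assms by (simp add: sum_adj_eq_degree regular_def subset_iff)
  also have "\<dots> = (\<Sum>u\<in>S. (\<Sum>v\<in>S. adj E u v) + (\<Sum>v\<in>V - S. adj E u v))"
    by (subst sum.subset_diff[OF assms(2) finite_vertices]) (simp add: add.commute)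
  finally show ?thesis by (simp add: cut_size_def sum.distrib)
qed

text \<open>The degree sum over \<open>S\<close> is the cut plus twice the number of inner edges.
  This serves to exclude sides of \<open>d + 1\<close> vertices when the cut is odd.\<close>

lemma (in simple_graph) cut_size_parity:
  assumes "regular d V E" "S \<subseteq> V"
  shows "even (card S * d) \<longleftrightarrow> even (cut_size V E S)"
proof -
  have "even (\<Sum>u\<in>S. \<Sum>v\<in>S. adj E u v :: nat)"
    using finite_subset[OF assms(2) finite_vertices] no_loop
    by (intro even_sum_sum_symmetric) (auto simp: insert_commute)
  then show ?thesis using degree_sum_side[OF assms] by simp
qed

text \<open>A vertex of \<open>S\<close> has at most \<open>card S - 1\<close> neighbours in
  \<open>S\<close>, so for \<open>1 \<le> card S \<le> d\<close> at least
  \<open>card S * (d - card S + 1) \<ge> d\<close> edges would leave \<open>S\<close>.\<close>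

lemma (in simple_graph) card_side_gt_degree:
  assumes "regular d V E" "S \<subseteq> V" "S \<noteq> {}" "cut_size V E S < d"
  shows "card S > d"
proof (rule ccontr)
  assume "\<not> ?thesis"
  then have le: "card S \<le> d" by simp
  have fin: "finite S" using assms(2) finite_vertices finite_subset by blast
  then have pos: "card S \<ge> 1" using assms(3) by (simp add: Suc_le_eq card_gt_0_iff)
  have "(\<Sum>u\<in>S. \<Sum>v\<in>S. adj E u v) \<le> (\<Sum>u\<in>S. card S - 1 :: nat)"
  proof (rule sum_mono)
    fix u assume "u \<in> S"
    then have "(\<Sum>v\<in>S. adj E u v) = (\<Sum>v\<in>S - {u}. adj E u v :: nat)"
      using no_loop by (subst sum.remove[OF fin]) auto
    also have "\<dots> \<le> (\<Sum>v\<in>S - {u}. 1)" by (rule sum_mono) simp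
    finally show "(\<Sum>v\<in>S. adj E u v) \<le> card S - 1" using \<open>u \<in> S\<close> fin by simp
  qed
  then have "card S * d < card S * (card S - 1) + d"
    using degree_sum_side[OF assms(1,2)] assms(4) by simp
  \<comment> \<open>With \<open>card S = a + 1\<close> and \<open>d = a + 1 + k\<close> the
    inequality becomes \<open>a * k < 0\<close>.\<close>
  moreover obtain a where a: "card S = Suc a" using pos by (cases "card S") auto
  moreover obtain k where "d = Suc a + k" using le a by (metis le_iff_add)
  ultimately show False by (simp add: algebra_simps)
qed

section \<open>Eigenvalue bounds for graphs with a small cut\<close>

lemma (in simple_graph) vertex_list: "distinct (vertex_list V)" "set (vertex_list V) = V"
  using someI_ex[of "\<lambda>vs. distinct vs \<and> set vs = V"] finite_distinct_list[OF finite_vertices]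
  unfolding vertex_list_def by blast+

text \<open>Restates the plane criterion as sums over vertices, by reindexing along
  \<open>vertex_list V\<close>. Eigenvalue number 2 sits at list index \<open>1\<close>.\<close>

lemma (in simple_graph) graph_eigenvalue_2_ge:
  assumes gh: "\<And>p q f. f = (\<lambda>v. p * g v + q * h v) \<Longrightarrow>
      \<theta> * (\<Sum>v\<in>V. (f v)\<^sup>2) \<le> (\<Sum>u\<in>V. \<Sum>v\<in>V. adj E u v * f u * f v)"
    and indep: "\<And>p q. p \<noteq> 0 \<or> q \<noteq> 0 \<Longrightarrow> \<exists>v\<in>V. p * g v + q * h v \<noteq> 0"
  shows "graph_eigenvalue 2 V E \<ge> \<theta>"
proof -
  let ?vs = "vertex_list V"
  define n where "n = length ?vs"
  define A where "A = adjacency_matrix ?vs E"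
  define vc where "vc f = vec n (\<lambda>i. f (?vs ! i) :: real)" for f
  have A: "A \<in> carrier_mat n n" "transpose_mat A = A"
    by (auto simp: A_def adjacency_matrix_def n_def insert_commute)
  have bij: "bij_betw ((!) ?vs) {..<n} V"
    using bij_betw_nth[OF vertex_list(1) _ vertex_list(2)[symmetric]] by (simp add: n_def)
  have lin: "p \<cdot>\<^sub>v vc g + q \<cdot>\<^sub>v vc h = vc (\<lambda>v. p * g v + q * h v)" for p q
    by (auto simp: vc_def)
  have sq: "vc f \<bullet> vc f = (\<Sum>v\<in>V. (f v)\<^sup>2)" for f
    using sum.reindex_bij_betw[OF bij, of "\<lambda>v. (f v)\<^sup>2"]
    by (simp add: vc_def scalar_prod_def power2_eq_square atLeast0LessThan)
  have form: "vc f \<bullet> (A *\<^sub>v vc f) = (\<Sum>u\<in>V. \<Sum>v\<in>V. adj E u v * f u * f v)" for f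
  proof -
    have "vc f \<bullet> (A *\<^sub>v vc f) = (\<Sum>i<n. \<Sum>j<n. adj E (?vs ! i) (?vs ! j) * f (?vs ! i) * f (?vs ! j))"
      by (auto simp: vc_def scalar_prod_def A_def adjacency_matrix_def n_def[symmetric] atLeast0LessThan
          sum_distrib_left intro!: sum.cong)
    also have "\<dots> = (\<Sum>i<n. \<Sum>v\<in>V. adj E (?vs ! i) v * f (?vs ! i) * f v)"
      by (intro sum.cong sum.reindex_bij_betw[OF bij] refl)
    also have "\<dots> = (\<Sum>u\<in>V. \<Sum>v\<in>V. adj E u v * f u * f v)"
      by (rule sum.reindex_bij_betw[OF bij])
    finally show ?thesis .
  qed
  have "\<theta> \<le> rev (sorted_list_of_multiset (proots (char_poly A))) ! 1"
  proof (rule second_eigenvalue_ge[OF A, of "vc g" "vc h"])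
    fix p q :: real assume "p \<noteq> 0 \<or> q \<noteq> 0"
    then obtain v where v: "v \<in> V" "p * g v + q * h v \<noteq> 0" using indep by blast
    then obtain i where "i < n" "v = ?vs ! i"
      using bij by (auto simp: bij_betw_def)
    then show "p \<cdot>\<^sub>v vc g + q \<cdot>\<^sub>v vc h \<noteq> 0\<^sub>v n"
      unfolding lin using v(2) by (metis vc_def index_vec index_zero_vec(1))
  next
    fix p q x assume "x = p \<cdot>\<^sub>v vc g + q \<cdot>\<^sub>v vc h"
    then show "\<theta> * (x \<bullet> x) \<le> x \<bullet> (A *\<^sub>v x)"
      using gh[OF refl] by (simp add: lin sq form)
  qed (simp_all add: vc_def)
  then show ?thesis
    by (simp add: graph_eigenvalue_def graph_eigenvalues_def graph_char_poly_def A_def)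
qed

text \<open>The two test functions live on \<open>S\<close> and on \<open>V - S\<close>, and
  \<open>D > 2\<close> keeps \<open>1 - \<alpha>\<close> positive, so they are independent. On each
  side a combination is a multiple of one of them, and the form of that side scales by
  \<open>p\<^sup>2\<close> or \<open>q\<^sup>2\<close>.\<close>

lemma (in simple_graph) graph_eigenvalue_2_ge_of_cut:
  fixes D \<epsilon> :: real
  assumes reg: "regular d V E" and S: "S \<subseteq> V"
    and D: "D > 2" "\<epsilon> > 0" "card S \<ge> D + \<epsilon> - 2" "card (V - S) \<ge> D + \<epsilon> - 2"
    and cut: "2 * real (cut_size V E S) \<le> \<epsilon> * D"
  shows "graph_eigenvalue 2 V E \<ge> d - \<epsilon>"
proof -
  define \<alpha> where "\<alpha> = 2 / D"
  have \<alpha>: "\<alpha> < 1" using D by (simp add: \<alpha>_def)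
  \<comment> \<open>Here \<open>X\<close> is the side opposite to \<open>u\<close>, so the value is
    lowered exactly at the ends of cut edges.\<close>
  define g where "g X u = (if (\<Sum>v\<in>X. adj E u v) = (0::real) then 1 else 1 - \<alpha>)" for X u
  have gpos: "g X u > 0" for X u using \<alpha> by (simp add: g_def)
  let ?T = "V - S"
  have fin: "finite S" "finite ?T" using S finite_vertices finite_subset by auto
  have V: "S \<union> ?T = V" using S by blast
  let ?P = "\<lambda>X Y. \<epsilon> * (\<Sum>u\<in>X. (g Y u)\<^sup>2) - 2 * (\<Sum>u\<in>X. (\<Sum>v\<in>Y. adj E u v) * (g Y u)\<^sup>2)
      - (\<Sum>u\<in>X. \<Sum>v\<in>X. adj E u v * (g Y u - g Y v)\<^sup>2) / 2"
  have side: "?P X Y \<ge> 0"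
    if "finite X" "finite Y" "card X \<ge> D + \<epsilon> - 2" "2 * (\<Sum>u\<in>X. \<Sum>v\<in>Y. adj E u v :: real) \<le> \<epsilon> * D" for X Y
  proof (rule two_valued_side_form_nonneg[OF that(1) _ D(2) \<alpha>_def that(3) _ that(4)])
    fix u
    have "(\<Sum>v\<in>Y. adj E u v :: real) = real (\<Sum>v\<in>Y. adj E u v)" by simp
    moreover have "real n = 0 \<or> 1 \<le> real n" for n by (cases n) auto
    ultimately show "(\<Sum>v\<in>Y. adj E u v :: real) = 0 \<or> 1 \<le> (\<Sum>v\<in>Y. adj E u v :: real)"
      by presburger
  qed (use D in \<open>auto simp: g_def\<close>)
  have cutS: "real (cut_size V E S) = (\<Sum>u\<in>S. \<Sum>v\<in>?T. adj E u v)"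
    unfolding cut_size_def of_nat_sum of_nat_of_bool ..
  have cutT: "real (cut_size V E S) = (\<Sum>u\<in>?T. \<Sum>v\<in>S. adj E u v)"
    unfolding cutS by (subst sum.swap) (simp add: insert_commute)
  have PS: "?P S ?T \<ge> 0"
    by (rule side[OF fin D(3)]) (use cut in \<open>simp only: cutS\<close>)
  have PT: "?P ?T S \<ge> 0"
    by (rule side[OF fin(2,1) D(4)]) (use cut in \<open>simp only: cutT\<close>)
  show ?thesis
  proof (rule graph_eigenvalue_2_ge[of "\<lambda>u. of_bool (u \<in> S) * g ?T u" "\<lambda>u. of_bool (u \<notin> S) * g S u"])
    fix p q :: real assume pq: "p \<noteq> 0 \<or> q \<noteq> 0"
    have "card S > 0" "card ?T > 0" using D by linarith+
    then obtain s t where "s \<in> S" "t \<in> ?T" by (metis card_gt_0_iff ex_in_conv)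
    then show "\<exists>v\<in>V. p * (of_bool (v \<in> S) * g ?T v) + q * (of_bool (v \<notin> S) * g S v) \<noteq> 0"
      using pq S gpos[of ?T s] gpos[of S t]
      by (cases "p = 0") (auto intro: bexI[of _ t] bexI[of _ s])
  next
    fix p q f
    assume f: "f = (\<lambda>u. p * (of_bool (u \<in> S) * g ?T u) + q * (of_bool (u \<notin> S) * g S u))"
    have fS: "f u = p * g ?T u" if "u \<in> S" for u using that by (simp add: f)
    have fT: "f u = q * g S u" if "u \<in> ?T" for u using that by (simp add: f)
    let ?Q = "\<lambda>X Y. \<epsilon> * (\<Sum>u\<in>X. (f u)\<^sup>2) - 2 * (\<Sum>u\<in>X. (\<Sum>v\<in>Y. adj E u v) * (f u)\<^sup>2)
      - (\<Sum>u\<in>X. \<Sum>v\<in>X. adj E u v * (f u - f v)\<^sup>2) / 2"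
    have scale: "?Q X Y = r\<^sup>2 * ?P X Y" if "\<And>u. u \<in> X \<Longrightarrow> f u = r * g Y u" for X Y r
    proof -
      have 1: "(\<Sum>u\<in>X. (f u)\<^sup>2) = r\<^sup>2 * (\<Sum>u\<in>X. (g Y u)\<^sup>2)"
        using that by (simp add: power_mult_distrib sum_distrib_left)
      have 2: "(\<Sum>u\<in>X. (\<Sum>v\<in>Y. adj E u v) * (f u)\<^sup>2) = r\<^sup>2 * (\<Sum>u\<in>X. (\<Sum>v\<in>Y. adj E u v) * (g Y u)\<^sup>2)"
        using that by (simp add: power_mult_distrib sum_distrib_left mult.left_commute)
      have 3: "(\<Sum>u\<in>X. \<Sum>v\<in>X. adj E u v * (f u - f v)\<^sup>2)
          = r\<^sup>2 * (\<Sum>u\<in>X. \<Sum>v\<in>X. adj E u v * (g Y u - g Y v)\<^sup>2)"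
        unfolding sum_distrib_left
        by (intro sum.cong refl) (simp add: that power_mult_distrib right_diff_distrib[symmetric])
      show ?thesis unfolding 1 2 3 by (simp add: algebra_simps)
    qed
    have "?Q S ?T = p\<^sup>2 * ?P S ?T" "?Q ?T S = q\<^sup>2 * ?P ?T S"
      by (intro scale fS fT; assumption)+
    then have nonneg: "?Q S ?T \<ge> 0" "?Q ?T S \<ge> 0"
      using mult_nonneg_nonneg[OF zero_le_power2 PS] mult_nonneg_nonneg[OF zero_le_power2 PT]
      by presburger+
    have split: "(\<Sum>u\<in>V. (f u)\<^sup>2) = (\<Sum>u\<in>S. (f u)\<^sup>2) + (\<Sum>u\<in>?T. (f u)\<^sup>2)"
      using sum.subset_diff[OF S finite_vertices] by (simp add: add.commute)
    have "(\<Sum>v\<in>S \<union> ?T. adj E u v) = real d" if "u \<in> S \<union> ?T" for u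
    proof -
      have "(\<Sum>v\<in>V. adj E u v) = real (\<Sum>v\<in>V. adj E u v)" by simp
      then show ?thesis
        using that reg unfolding V sum_adj_eq_degree regular_def by simp
    qed
    from adjacency_form_cut_bound[where f = f and w = "adj E", OF fin _ _ _ this]
    show "(real d - \<epsilon>) * (\<Sum>v\<in>V. (f v)\<^sup>2) \<le> (\<Sum>u\<in>V. \<Sum>v\<in>V. adj E u v * f u * f v)"
      using nonneg unfolding V split by (simp add: insert_commute algebra_simps del: sum_of_bool_eq)
  qed
qed

lemma (in simple_graph) graph_eigenvalue_2_ge_of_small_cut:
  fixes k t :: real
  assumes reg: "regular d V E" and S: "S \<subseteq> V" and k: "k \<ge> 3" and t: "0 < t" "t \<le> d - 1" and d: "d \<ge> 2"
    and card: "card S \<ge> d + k - 2" "card (V - S) \<ge> d + k - 2" and cut: "cut_size V E S \<le> t"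
  shows "graph_eigenvalue 2 V E \<ge> (real d - k + sqrt ((d + k)\<^sup>2 - 8 * t)) / 2"
proof -
  define s where "s = sqrt ((d + k)\<^sup>2 - 8 * t)"
  have "(real d + 3)\<^sup>2 \<le> (d + k)\<^sup>2" using k by (intro power_mono) auto
  \<comment> \<open>For \<open>t = d - 1\<close> the difference is
    \<open>(d - 1)\<^sup>2 + 16\<close>, so the radicand is nonnegative.\<close>
  moreover have "8 * t \<le> (real d + 3)\<^sup>2"
    using t zero_le_power2[of "real d - 1"] by (simp add: power2_eq_square algebra_simps)
  ultimately have s2: "s\<^sup>2 = (d + k)\<^sup>2 - 8 * t" by (simp add: s_def)
  have s0: "s \<ge> 0" using s2 \<open>_ \<le> (d + k)\<^sup>2\<close> \<open>8 * t \<le> _\<close> by (simp add: s_def)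
  have "s < d + k"
    using s2 t k by (intro power2_less_imp_less[of s]) auto
  \<comment> \<open>The roots of \<open>x\<^sup>2 - (d + k) * x + 2 * t\<close>. Taking the smaller
    one as \<epsilon> gives the larger bound \<open>d - \<epsilon>\<close>.\<close>
  define \<epsilon> D where "\<epsilon> = (d + k - s) / 2" and "D = (d + k + s) / 2"
  have "\<epsilon> * D = ((d + k)\<^sup>2 - s\<^sup>2) / 4"
    by (simp add: \<epsilon>_def D_def power2_eq_square algebra_simps)
  then have "\<epsilon> * D = 2 * t" using s2 by simp
  moreover have "D + \<epsilon> - 2 = d + k - 2" by (simp add: \<epsilon>_def D_def field_simps)
  moreover have "D > 2" "\<epsilon> > 0" using s0 k d \<open>s < d + k\<close> by (auto simp: \<epsilon>_def D_def)
  ultimately have "graph_eigenvalue 2 V E \<ge> d - \<epsilon>"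
    using graph_eigenvalue_2_ge_of_cut[OF reg S, of D \<epsilon>] card cut by simp
  then show ?thesis by (simp add: \<epsilon>_def s_def field_simps)
qed

section \<open>From edge-connectivity to a small cut\<close>

text \<open>Some set \<open>F\<close> of at most \<open>t\<close> edges disconnects the graph. The
  component of a vertex after deleting \<open>F\<close> serves as \<open>S\<close>, since every edge
  leaving it belongs to \<open>F\<close>.\<close>

lemma (in simple_graph) small_cut_if_edge_connectivity_le:
  assumes reg: "regular d V E" and "d > 0" and "edge_connectivity V E < Suc t"
  shows "\<exists>S\<subseteq>V. S \<noteq> {} \<and> S \<noteq> V \<and> cut_size V E S \<le> t"
proof -
  have finE: "finite E" using edges finite_vertices
    by (meson PowI finite_Pow_iff finite_subset subsetI)
  \<comment> \<open>As \<open>d > 0\<close> there is an edge, hence two distinct vertices; with a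
    single vertex the maximum would be unspecified.\<close>
  obtain x where "x \<in> V" using vertices_nonempty by blast
  then have "card {e \<in> E. x \<in> e} \<noteq> 0" using reg \<open>d > 0\<close> by (auto simp: regular_def vertex_degree_def)
  then obtain e where "e \<in> E" by (metis (no_types, lifting) card.empty empty_Collect_eq)
  then obtain a b where ab: "a \<in> V" "b \<in> V" "a \<noteq> b" using edges[of e] by (auto simp: card_2_iff)
  \<comment> \<open>Deleting all edges separates \<open>a\<close> from \<open>b\<close>. This bounds
    the admissible \<open>m\<close>, so that \<open>GREATEST\<close> is an actual maximum.\<close>
  have "m \<le> card E" if "edge_connected m V E" for m
  proof (rule ccontr)
    assume "\<not> m \<le> card E"
    then have "connected_graph V (E - E)" using that by (auto simp: edge_connected_def)
    then have "(a, b) \<in> {(x, y). {x, y} \<in> E - E}\<^sup>*" using ab by (auto simp: connected_graph_def)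
    then show False using ab(3) by simp
  qed
  then have "\<not> edge_connected (Suc t) V E"
    using Greatest_le_nat[of "\<lambda>m. edge_connected m V E" "Suc t" "card E"] assms(3)
    unfolding edge_connectivity_def by auto
  then obtain F u v where F: "F \<subseteq> E" "card F < Suc t" and uv: "u \<in> V" "v \<in> V"
    "(u, v) \<notin> {(x, y). {x, y} \<in> E - F}\<^sup>*" (is "_ \<notin> ?R\<^sup>*")
    by (auto simp: edge_connected_def connected_graph_def)
  define S where "S = {x \<in> V. (u, x) \<in> ?R\<^sup>*}"
  have S: "S \<subseteq> V" "u \<in> S" "v \<notin> S" using uv by (auto simp: S_def)
  have finF: "finite F" using F(1) finE finite_subset by blast
  have fin: "finite S" "finite (V - S)" using S finite_vertices finite_subset by auto
  let ?C = "Sigma S (\<lambda>u. {v \<in> V - S. {u, v} \<in> E})"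
  have "cut_size V E S = card ?C"
    using fin by (simp add: cut_size_def Int_def)
  also have "\<dots> \<le> card F"
  \<comment> \<open>Exactly one end of each such edge lies in \<open>S\<close>, so the edge
    determines the ordered pair.\<close>
  proof (rule card_inj_on_le[of "\<lambda>(x, y). {x, y}"])
    show "inj_on (\<lambda>(x, y). {x, y}) ?C" by (auto simp: inj_on_def doubleton_eq_iff)
    show "(\<lambda>(x, y). {x, y}) ` ?C \<subseteq> F"
    proof clarify
      fix x y assume xy: "x \<in> S" "y \<in> V" "y \<notin> S" "{x, y} \<in> E"
      show "{x, y} \<in> F"
      proof (rule ccontr)
        assume "{x, y} \<notin> F"
        then have "(x, y) \<in> ?R" using xy by simp
        then have "(u, y) \<in> ?R\<^sup>*" using xy(1) unfolding S_def by (blast intro: rtrancl_into_rtrancl)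
        then show False using xy by (simp add: S_def)
      qed
    qed
  qed (rule finF)
  finally show ?thesis using S F(2) uv by (intro exI[of _ S]) auto
qed

section \<open>The two thresholds, by the parity of the cut\<close>

theorem theorem3p3:
  fixes V :: "'a set" and E :: "'a set set" and d t :: nat
  assumes "d > 0" and "t > 0" and "3 \<le> t" and "t \<le> d - 1"
    and "simple_graph V E" and "regular d V E"
  shows "(graph_eigenvalue 2 V E < (real d - 3 + sqrt ((real d + 3)\<^sup>2 - 8 * real t)) / 2
            \<longrightarrow> edge_connectivity V E \<ge> t + 1) \<and>
         (odd t \<longrightarrow>
          graph_eigenvalue 2 V E < (real d - 4 + sqrt ((real d + 4)\<^sup>2 - 8 * real t)) / 2
            \<longrightarrow> edge_connectivity V E \<ge> t + 1)"
proof (cases "edge_connectivity V E \<ge> t + 1")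
  \<comment> \<open>Both implications share their conclusion; where it fails, both eigenvalue
    hypotheses are refuted.\<close>
  case False
  interpret simple_graph V E by fact
  note reg = \<open>regular d V E\<close>
  obtain S where S: "S \<subseteq> V" "S \<noteq> {}" "S \<noteq> V" and cut: "cut_size V E S \<le> t"
    using small_cut_if_edge_connectivity_le[OF reg \<open>d > 0\<close>, of t] False by auto
  note T = cut_size_complement[OF S(1)]
  have "cut_size V E S < d" using cut assms by linarith
  then have large: "card S > d" "card (V - S) > d"
    using card_side_gt_degree[OF reg, of S] card_side_gt_degree[OF reg, of "V - S"] S T by auto
  \<comment> \<open>The case \<open>k = 3\<close>, where \<open>d + k - 2 = d + 1\<close>. It is
    applied with \<open>r = t\<close> and, for even cuts, with \<open>r = t - 1\<close>.\<close>
  have bound3: "graph_eigenvalue 2 V E \<ge> (real d - 3 + sqrt ((real d + 3)\<^sup>2 - 8 * r)) / 2"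
    if "0 < r" "r \<le> real d - 1" "cut_size V E S \<le> r" for r :: real
    using graph_eigenvalue_2_ge_of_small_cut[OF reg S(1), of 3 r] that large assms by simp
  have "graph_eigenvalue 2 V E \<ge> (real d - 4 + sqrt ((real d + 4)\<^sup>2 - 8 * real t)) / 2" if "odd t"
  proof (cases "even (cut_size V E S)")
    case True
    then have "cut_size V E S \<noteq> t" using \<open>odd t\<close> by auto
    then have "cut_size V E S \<le> real t - 1" using cut by linarith
    then have "graph_eigenvalue 2 V E \<ge> (real d - 3 + sqrt ((real d + 3)\<^sup>2 - 8 * (real t - 1))) / 2"
      using assms by (intro bound3) auto
    \<comment> \<open>With \<open>r\<close> for the root on the right, squaring reduces this to
      \<open>d - 1 \<le> r\<close>.\<close>
    moreover have "sqrt ((real d + 4)\<^sup>2 - 8 * real t) \<le> 1 + sqrt ((real d + 3)\<^sup>2 - 8 * (real t - 1))"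
    proof -
      define r where "r = sqrt ((real d + 3)\<^sup>2 - 8 * (real t - 1))"
      have td: "real t \<le> d - 1" using assms by linarith
      have "(real d - 1)\<^sup>2 \<le> (real d + 3)\<^sup>2 - 8 * (real t - 1)"
        using td by (simp add: power2_eq_square algebra_simps)
      moreover from this have "0 \<le> (real d + 3)\<^sup>2 - 8 * (real t - 1)"
        using zero_le_power2 order_trans by blast
      ultimately have "real d - 1 \<le> r" "r\<^sup>2 = (real d + 3)\<^sup>2 - 8 * (real t - 1)" "0 \<le> r"
        unfolding r_def by (simp_all add: real_le_rsqrt)
      then have "(real d + 4)\<^sup>2 - 8 * real t \<le> (1 + r)\<^sup>2"
        by (simp add: power2_eq_square algebra_simps)
      then show ?thesis using \<open>0 \<le> r\<close> unfolding r_def[symmetric] by (intro real_le_lsqrt) auto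
    qed
    ultimately show ?thesis by simp
  next
    case False
    then have odd: "odd (card S * d)" "odd (card (V - S) * d)"
      using cut_size_parity[OF reg, of S] cut_size_parity[OF reg, of "V - S"] S T by auto
    \<comment> \<open>The product \<open>Suc d * d\<close> is even. Excluding it leaves at least
      \<open>d + 2\<close> vertices on each side, the size required for
      \<open>k = 4\<close>.\<close>
    then have "card S \<noteq> Suc d" "card (V - S) \<noteq> Suc d" by auto
    then have "card S \<ge> d + 2" "card (V - S) \<ge> d + 2" using large by linarith+
    then show ?thesis
      using graph_eigenvalue_2_ge_of_small_cut[OF reg S(1), of 4 t] cut assms by simp
  qed
  moreover have "graph_eigenvalue 2 V E \<ge> (real d - 3 + sqrt ((real d + 3)\<^sup>2 - 8 * real t)) / 2"
    using cut assms by (intro bound3) auto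
  ultimately show ?thesis by auto
qed simp

end
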